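(* Let $r\geq 1$ be an integer. (i) The function $\zeta_r(s)$ has poles only at the points $s=1/k$ with $1\leq k\leq r$, and the pole at $s=1/k$ has order $[r/k]$, where $[x]$ denotes the integer part of $x$. (ii) For each $1\leq k\leq r$, as $s\to 1/k$, $$\zeta_r(s)\sim C_r(k)\,(ks-1)^{-[r/k]},$$ where $C_r(k)$ is a non-zero real constant whose sign coincides with the sign of $(-1)^{r+[r/k]}$.
   Context: For an integer $r\geq 1$, $\zeta_r(s)=\zeta_r(s,s,\ldots,s)$ denotes the Euler–Zagier $r$-fold zeta-function with all $r$ arguments equal to $s$, i.e. the meromorphic continuation to $\mathbb{C}$ of $\sum_{1\leq m_1<m_2<\cdots<m_r}(m_1m_2\cdots m_r)^{-s}$ (absolutely convergent for $\Re s>1$). In particular $\zeta_1(s)=\zeta(s)$ is the Riemann zeta-function. *)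

theory Defs
  imports "HOL-Complex_Analysis.Complex_Analysis" "HOL-Library.Landau_Symbols"
begin

definition EZ_tuples :: "nat \<Rightarrow> nat list set" where
  "EZ_tuples r = {ms. length ms = r \<and> sorted_wrt (<) ms \<and> (\<forall>m\<in>set ms. 1 \<le> m)}"

definition EZ_series :: "nat \<Rightarrow> complex \<Rightarrow> complex" where
  "EZ_series r s = (\<Sum>\<^sub>\<infinity>ms\<in>EZ_tuples r. of_nat (prod_list ms) powr (-s))"

definition EZ_continuation :: "nat \<Rightarrow> (complex \<Rightarrow> complex) \<Rightarrow> bool" where
  "EZ_continuation r f \<longleftrightarrow>
     f nicely_meromorphic_on UNIV \<and> (\<forall>s. Re s > 1 \<longrightarrow> f s = EZ_series r s)"

text \<open>
  A nicely meromorphic function is continuous away from its poles and takes the conventional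
  value 0 at them, so a continuation is unique as a total function on the complex plane.
\<close>

lemma EZ_continuation_unique:
  assumes f: "EZ_continuation r f" and g: "EZ_continuation r g"
  shows "f = g"
proof -
  have mf: "f nicely_meromorphic_on UNIV" and mg: "g nicely_meromorphic_on UNIV"
    using f g by (auto simp: EZ_continuation_def)
  define h where "h = (\<lambda>s. f s - g s)"
  have mh: "h meromorphic_on UNIV"
    using mf mg unfolding h_def nicely_meromorphic_on_def by (intro meromorphic_intros) auto
  have nh: "remove_sings h nicely_meromorphic_on UNIV"
    using mh by (rule remove_sings_nicely_meromorphic)
  have ev: "eventually (\<lambda>w. h w = 0) (nhds s)" if "Re s > 1" for s
  proof -
    have "eventually (\<lambda>w. w \<in> {w. Re w > 1}) (nhds s)"
      using that by (intro eventually_nhds_in_open open_halfspace_Re_gt) auto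
    thus ?thesis
      by eventually_elim (use f g in \<open>auto simp: EZ_continuation_def h_def\<close>)
  qed
  have rh0: "remove_sings h s = 0" if "Re s > 1" for s
  proof (rule remove_sings_eqI)
    have "eventually (\<lambda>w. h w = 0) (at s)"
      using ev[OF that] by (simp add: eventually_nhds_conv_at)
    thus "h \<midarrow>s\<rightarrow> 0"
      by (rule tendsto_eventually)
  qed
  have "eventually (\<lambda>w. remove_sings h w = 0) (nhds 2)"
  proof -
    have "eventually (\<lambda>w. w \<in> {w. Re w > 1}) (nhds 2)"
      by (intro eventually_nhds_in_open open_halfspace_Re_gt) auto
    thus ?thesis by eventually_elim (auto simp: rh0)
  qed
  hence "eventually (\<lambda>w. remove_sings h w = 0) (at 2)"
    by (simp add: eventually_nhds_conv_at)
  hence "frequently (\<lambda>w. remove_sings h w = 0) (at 2)"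
    by (intro eventually_frequently) auto
  hence rz: "remove_sings h w = 0" for w
    by (rule frequently_eq_meromorphic_imp_constant) (use nh in auto)
  have eq_at: "eventually (\<lambda>w. f w = g w) (at z)" for z
  proof -
    have "isolated_singularity_at h z"
      using mh by (meson UNIV_I meromorphic_on_isolated_singularity meromorphic_on_subset subset_UNIV)
    hence "eventually (\<lambda>w. remove_sings h w = h w) (at z)"
      by (rule eventually_remove_sings_eq_at)
    thus ?thesis by eventually_elim (simp add: rz[unfolded h_def] h_def)
  qed
  show "f = g"
  proof
    fix z
    have pole: "is_pole f z \<longleftrightarrow> is_pole g z"
      using eq_at by (intro is_pole_cong) auto
    show "f z = g z"
    proof (cases "is_pole f z")
      case True
      hence "is_pole g z" using pole by simp
      with True show ?thesis using mf mg
        unfolding nicely_meromorphic_on_def is_pole_def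
        by (metis UNIV_I at_neq_bot not_tendsto_and_filterlim_at_infinity)
    next
      case False
      hence "f \<midarrow>z\<rightarrow> f z" "g \<midarrow>z\<rightarrow> g z"
        using mf mg pole unfolding nicely_meromorphic_on_def by auto
      moreover from this(1) have "g \<midarrow>z\<rightarrow> f z"
        using tendsto_cong[OF eq_at[of z]] by simp
      ultimately show ?thesis
        using tendsto_unique[OF at_neq_bot] by blast
    qed
  qed
qed

definition EZ_zeta :: "nat \<Rightarrow> complex \<Rightarrow> complex" where
  "EZ_zeta r = (THE f. EZ_continuation r f)"

lemma EZ_zeta_eqI: "EZ_continuation r f \<Longrightarrow> EZ_zeta r = f"
  unfolding EZ_zeta_def by (blast intro: EZ_continuation_unique)

end

theory Submission
  imports Defs
begin

text \<open>
  The series of \<open>\<zeta>\<^sub>r\<close> is the \<open>r\<close>-th elementary symmetric function of the numbers \<open>n powr (-s)\<close>, whose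
  power sums are \<open>\<zeta>(js)\<close>. Newton's identities therefore give
  \<open>r \<zeta>\<^sub>r(s) = \<Sum>j=1..r. (-1) ^ (j - 1) \<zeta>(js) \<zeta>\<^bsub>r-j\<^esub>(s)\<close>, so the continuation of \<open>\<zeta>\<close> yields that of
  \<open>\<zeta>\<^sub>r\<close>, and poles can only come from the factors \<open>\<zeta>(ks)\<close> at \<open>s = 1/k\<close>. Multiplying the recursion by
  \<open>(ks - 1) ^ (r div k)\<close> and letting \<open>s \<rightarrow> 1/k\<close>, only the term \<open>j = k\<close> and those terms \<open>j < k\<close> with
  \<open>(r - j) div k = r div k\<close> survive. Because \<open>\<zeta> < 0\<close> on the interval from \<open>0\<close> to \<open>1\<close>, all surviving
  terms inductively have the sign of \<open>(-1) ^ (r + r div k)\<close>, so they cannot cancel.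

  For \<open>\<zeta>\<close> itself, a telescoping series continues \<open>(s - 1) \<zeta>(s)\<close> to \<open>Re s > 0\<close>, and the alternating
  series for \<open>(1 - 2 powr (1 - s)) \<zeta>(s)\<close>, accelerated by Euler's transformation, does the rest.
\<close>

section \<open>Elementary symmetric functions of infinitely many variables\<close>

definition bounded_tuples :: "nat \<Rightarrow> nat \<Rightarrow> nat list set" where
  "bounded_tuples r N = {ms \<in> EZ_tuples r. set ms \<subseteq> {..N}}"

lemma bounded_tuples_0 [simp]: "bounded_tuples 0 N = {[]}"
  by (auto simp: bounded_tuples_def EZ_tuples_def)

lemma bounded_tuples_Suc_0 [simp]: "bounded_tuples (Suc r) 0 = {}"
  by (auto simp: bounded_tuples_def EZ_tuples_def length_Suc_conv)

text \<open>Tuples are increasing, so the last entry is the largest; the split is by whether it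
  equals \<open>Suc N\<close>.\<close>

lemma bounded_tuples_Suc_Suc:
  "bounded_tuples (Suc r) (Suc N) =
     bounded_tuples (Suc r) N \<union> (\<lambda>ms. ms @ [Suc N]) ` bounded_tuples r N"
proof (intro equalityI subsetI)
  fix ms assume ms: "ms \<in> bounded_tuples (Suc r) (Suc N)"
  hence "ms \<noteq> []"
    by (auto simp: bounded_tuples_def EZ_tuples_def)
  then obtain ns n where ns: "ms = ns @ [n]"
    by (metis append_butlast_last_id)
  have *: "length ns = r" "sorted_wrt (<) ns" "\<forall>m\<in>set ns. m < n \<and> 1 \<le> m" "1 \<le> n" "n \<le> Suc N"
    using ms by (auto simp: ns bounded_tuples_def EZ_tuples_def sorted_wrt_append)
  show "ms \<in> bounded_tuples (Suc r) N \<union> (\<lambda>ms. ms @ [Suc N]) ` bounded_tuples r N"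
  proof (cases "n = Suc N")
    case True
    thus ?thesis using * by (auto simp: ns bounded_tuples_def EZ_tuples_def less_Suc_eq_le)
  next
    case False
    thus ?thesis using *
      by (fastforce simp: ns bounded_tuples_def EZ_tuples_def sorted_wrt_append)
  qed
qed (auto simp: bounded_tuples_def EZ_tuples_def sorted_wrt_append less_Suc_eq_le le_SucI)

lemma finite_bounded_tuples [simp]: "finite (bounded_tuples r N)"
proof (induction N arbitrary: r)
  case 0
  thus ?case by (cases r) auto
next
  case (Suc N)
  thus ?case by (cases r) (auto simp: bounded_tuples_Suc_Suc)
qed

lemma bounded_tuples_subset: "bounded_tuples r N \<subseteq> EZ_tuples r"
  by (auto simp: bounded_tuples_def)

lemma finite_subset_bounded_tuples:
  assumes "finite F" "F \<subseteq> EZ_tuples r"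
  shows   "\<exists>N0. \<forall>N\<ge>N0. F \<subseteq> bounded_tuples r N"
proof (intro exI allI impI subsetI)
  fix N ms assume N: "N \<ge> Max (insert 0 (\<Union>(set ` F)))" and ms: "ms \<in> F"
  have "m \<le> Max (insert 0 (\<Union>(set ` F)))" if "m \<in> set ms" for m
    using assms ms that by (intro Max_ge) auto
  with N ms assms show "ms \<in> bounded_tuples r N"
    by (force simp: bounded_tuples_def)
qed

section \<open>Elementary symmetric polynomials, Newton's identities and their infinite
  version\<close>

definition elem_sym :: "(nat \<Rightarrow> 'a::field_char_0) \<Rightarrow> nat \<Rightarrow> nat \<Rightarrow> 'a" where
  "elem_sym x N r = (\<Sum>ms\<in>bounded_tuples r N. prod_list (map x ms))"

lemma elem_sym_0 [simp]: "elem_sym x N 0 = 1"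
  by (simp add: elem_sym_def)

lemma elem_sym_Suc:
  "elem_sym x (Suc N) (Suc r) = elem_sym x N (Suc r) + x (Suc N) * elem_sym x N r"
proof -
  have "bounded_tuples (Suc r) N \<inter> (\<lambda>ms. ms @ [Suc N]) ` bounded_tuples r N = {}"
    by (auto simp: bounded_tuples_def)
  moreover have "inj_on (\<lambda>ms. ms @ [Suc N]) (bounded_tuples r N)"
    by (auto simp: inj_on_def)
  ultimately show ?thesis
    by (simp add: elem_sym_def bounded_tuples_Suc_Suc sum.union_disjoint sum.reindex
          sum_distrib_left mult.commute)
qed

text \<open>The recursion \<open>elem_sym_Suc\<close> is multiplication by one more linear factor,
  read off coefficientwise.\<close>

lemma elem_sym_fps:
  "Abs_fps (elem_sym x N) = (\<Prod>n=1..N. 1 + fps_const (x n) * fps_X)"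
proof (induction N)
  case 0
  have "elem_sym x 0 r = fps_nth (1 :: 'a fps) r" for r
    by (cases r) (auto simp: elem_sym_def)
  thus ?case by (simp add: fps_eq_iff)
next
  case (Suc N)
  have "Abs_fps (elem_sym x (Suc N)) = Abs_fps (elem_sym x N) * (1 + fps_const (x (Suc N)) * fps_X)"
  proof (rule fps_ext)
    fix r
    show "fps_nth (Abs_fps (elem_sym x (Suc N))) r =
            fps_nth (Abs_fps (elem_sym x N) * (1 + fps_const (x (Suc N)) * fps_X)) r"
      by (cases r) (simp_all add: elem_sym_Suc ring_distribs flip: mult.assoc)
  qed
  thus ?case by (simp add: Suc.IH)
qed

text \<open>Logarithmic differentiation of the generating product: \<open>E\<close> satisfies E' = E
  P, where \<open>P\<close> has the signed power sums as coefficients, and comparing coefficients of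
  degree \<open>r\<close> gives the identity.\<close>

lemma Newton_identity:
  fixes x :: "nat \<Rightarrow> 'a::field_char_0"
  shows "of_nat (Suc r) * elem_sym x N (Suc r) =
           (\<Sum>i\<le>r. elem_sym x N i * ((-1) ^ (r - i) * (\<Sum>n=1..N. x n ^ Suc (r - i))))"
proof -
  define E where "E = (\<lambda>N. \<Prod>n=1..N. 1 + fps_const (x n) * fps_X)"
  define P where "P = (\<lambda>N. Abs_fps (\<lambda>j. (-1) ^ j * (\<Sum>n=1..N. x n ^ Suc j)))"
  have deriv: "fps_deriv (E N) = E N * P N" for N
  proof (induction N)
    case 0
    thus ?case by (simp add: E_def P_def fps_eq_iff)
  next
    case (Suc N)
    define c where "c = x (Suc N)"
    \<comment> \<open>The geometric series of c / (1 + c X), which is the logarithmic derivative of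
      the new factor.\<close>
    define G where "G = Abs_fps (\<lambda>j. (-1) ^ j * c ^ Suc j)"
    have P: "P (Suc N) = P N + G"
      by (simp add: P_def G_def c_def fps_eq_iff algebra_simps)
    have G: "(1 + fps_const c * fps_X) * G = fps_const c"
    proof (rule fps_ext)
      fix j show "fps_nth ((1 + fps_const c * fps_X) * G) j = fps_nth (fps_const c) j"
        by (cases j) (simp_all add: G_def algebra_simps)
    qed
    have E: "E (Suc N) = E N * (1 + fps_const c * fps_X)"
      by (simp add: E_def c_def)
    have "fps_deriv (E (Suc N)) =
            E N * P N * (1 + fps_const c * fps_X) + E N * fps_const c"
      by (simp add: E Suc.IH)
    also have "\<dots> = E (Suc N) * P (Suc N)"
      by (subst G [symmetric]) (simp add: E P algebra_simps)
    finally show ?case .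
  qed
  have E: "E N = Abs_fps (elem_sym x N)"
    unfolding E_def elem_sym_fps ..
  have "of_nat (Suc r) * elem_sym x N (Suc r) = fps_nth (fps_deriv (E N)) r"
    by (simp add: E)
  also have "\<dots> = (\<Sum>i\<le>r. elem_sym x N i * ((-1) ^ (r - i) * (\<Sum>n=1..N. x n ^ Suc (r - i))))"
    unfolding deriv fps_mult_nth atLeast0AtMost by (simp add: E P_def)
  finally show ?thesis .
qed

text \<open>Newton's identities solved for the elementary symmetric functions, with an arbitrary
  \<open>p\<close> in place of the power sums. The same recursion then describes both the limit of
  the partial sums and the meromorphic continuation.\<close>

fun newton_sym :: "(nat \<Rightarrow> 'a::field_char_0) \<Rightarrow> nat \<Rightarrow> 'a" where
  "newton_sym p 0 = 1"
| "newton_sym p (Suc r) =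
     (\<Sum>i\<le>r. newton_sym p i * ((-1) ^ (r - i) * p (Suc (r - i)))) / of_nat (Suc r)"

lemma elem_sym_tendsto:
  fixes x :: "nat \<Rightarrow> 'a::real_normed_field"
  assumes "\<And>j. j \<ge> 1 \<Longrightarrow> (\<lambda>N. \<Sum>n=1..N. x n ^ j) \<longlonglongrightarrow> p j"
  shows   "(\<lambda>N. elem_sym x N r) \<longlonglongrightarrow> newton_sym p r"
proof (induction r rule: less_induct)
  case (less r)
  show ?case
  proof (cases r)
    case 0
    thus ?thesis by simp
  next
    case (Suc q)
    have eq: "elem_sym x N (Suc q) =
            (\<Sum>i\<le>q. elem_sym x N i * ((-1) ^ (q - i) * (\<Sum>n=1..N. x n ^ Suc (q - i)))) /
              of_nat (Suc q)" for N
      using Newton_identity[of q x N] by (simp add: field_simps del: of_nat_Suc)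
    show ?thesis
      unfolding Suc eq newton_sym.simps using less.IH Suc assms
      by (intro tendsto_intros) (auto simp del: of_nat_Suc power_Suc)
  qed
qed

text \<open>The hypothesis on norms yields absolute summability: finite sums of norms are bounded by
  elementary symmetric polynomials in the norms, which converge as \<open>N\<close> grows.\<close>

lemma infsum_EZ_tuples:
  fixes x :: "nat \<Rightarrow> 'a::{real_normed_field, banach}"
  assumes p: "\<And>j. j \<ge> 1 \<Longrightarrow> (\<lambda>N. \<Sum>n=1..N. x n ^ j) \<longlonglongrightarrow> p j"
  assumes q: "\<And>j. j \<ge> 1 \<Longrightarrow> (\<lambda>N. \<Sum>n=1..N. norm (x n) ^ j) \<longlonglongrightarrow> q j"
  shows "(\<Sum>\<^sub>\<infinity>ms\<in>EZ_tuples r. prod_list (map x ms)) = newton_sym p r"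
proof -
  have norm_prod: "norm (prod_list (map x ms)) = prod_list (map (\<lambda>n. norm (x n)) ms)" for ms
    by (induction ms) (auto simp: norm_mult)
  have "convergent (\<lambda>N. elem_sym (\<lambda>n. norm (x n)) N r)"
    using elem_sym_tendsto[OF q] unfolding convergent_def by blast
  hence "Bseq (\<lambda>N. elem_sym (\<lambda>n. norm (x n)) N r)"
    by (rule convergent_imp_Bseq)
  then obtain B where B: "\<And>N. norm (elem_sym (\<lambda>n. norm (x n)) N r) \<le> B"
    unfolding Bseq_def by auto
  have "(\<lambda>ms. norm (prod_list (map x ms))) summable_on EZ_tuples r"
  proof (rule nonneg_bdd_above_summable_on)
    show "bdd_above (sum (\<lambda>ms. norm (prod_list (map x ms))) ` {F. F \<subseteq> EZ_tuples r \<and> finite F})"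
    proof (rule bdd_aboveI2)
      fix F assume F: "F \<in> {F. F \<subseteq> EZ_tuples r \<and> finite F}"
      then obtain N where "F \<subseteq> bounded_tuples r N"
        using finite_subset_bounded_tuples[of F r] by auto
      hence "(\<Sum>ms\<in>F. norm (prod_list (map x ms))) \<le>
               (\<Sum>ms\<in>bounded_tuples r N. norm (prod_list (map x ms)))"
        by (intro sum_mono2) auto
      also have "\<dots> \<le> B"
        using B[of N] by (simp add: elem_sym_def norm_prod)
      finally show "(\<Sum>ms\<in>F. norm (prod_list (map x ms))) \<le> B" .
    qed
  qed auto
  hence "(\<lambda>ms. prod_list (map x ms)) summable_on EZ_tuples r"
    by (rule abs_summable_summable)
  hence lim: "(sum (\<lambda>ms. prod_list (map x ms)) \<longlongrightarrow>
              (\<Sum>\<^sub>\<infinity>ms\<in>EZ_tuples r. prod_list (map x ms))) (finite_subsets_at_top (EZ_tuples r))"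
    using has_sum_infsum has_sum_def by blast
  \<comment> \<open>The truncations are cofinal among the finite sets of tuples, so the unordered
    sum can be evaluated along them.\<close>
  have "filterlim (bounded_tuples r) (finite_subsets_at_top (EZ_tuples r)) sequentially"
    unfolding filterlim_finite_subsets_at_top
  proof safe
    fix F assume F: "finite F" "F \<subseteq> EZ_tuples r"
    from finite_subset_bounded_tuples[OF this] obtain N0 where "\<forall>N\<ge>N0. F \<subseteq> bounded_tuples r N"
      by blast
    thus "\<forall>\<^sub>F N in sequentially. finite (bounded_tuples r N) \<and> F \<subseteq> bounded_tuples r N \<and>
            bounded_tuples r N \<subseteq> EZ_tuples r"
      unfolding eventually_sequentially using finite_bounded_tuples bounded_tuples_subset by blast
  qed
  from filterlim_compose[OF lim this]
  have "(\<lambda>N. elem_sym x N r) \<longlonglongrightarrow> (\<Sum>\<^sub>\<infinity>ms\<in>EZ_tuples r. prod_list (map x ms))"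
    by (simp add: elem_sym_def)
  with elem_sym_tendsto[OF p] show ?thesis
    using LIMSEQ_unique by blast
qed


section \<open>The Riemann zeta function\<close>

text \<open>With \<open>d\<close> half the distance from \<open>z\<close> to the boundary line, the
  exponent stays at most \<open>-d - 1\<close> on the disc, and monotonicity of \<open>K\<close>
  replaces \<open>K (norm w)\<close> by a constant. This gives the majorant for the Weierstrass
  test.\<close>

lemma halfplane_dominated:
  fixes f :: "nat \<Rightarrow> complex \<Rightarrow> complex" and K :: "real \<Rightarrow> real"
  assumes bound: "\<And>n s. Re s > a \<Longrightarrow> norm (f n s) \<le> K (norm s) * real (Suc n) powr (a - Re s - 1)"
  assumes K: "\<And>t. t \<ge> 0 \<Longrightarrow> K t \<ge> 0" "\<And>t u. 0 \<le> t \<Longrightarrow> t \<le> u \<Longrightarrow> K t \<le> K u"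
  assumes z: "Re z > a"
  obtains d M where "d > 0" "cball z d \<subseteq> {s. Re s > a}" "summable M"
    "\<And>n w. w \<in> cball z d \<Longrightarrow> norm (f n w) \<le> M n"
proof -
  define d where "d = (Re z - a) / 2"
  have d: "d > 0" using z by (simp add: d_def)
  have Re: "Re w - a \<ge> d" if "w \<in> cball z d" for w
  proof -
    have "\<bar>Re (z - w)\<bar> \<le> d"
      using abs_Re_le_cmod[of "z - w"] that unfolding mem_cball dist_norm by linarith
    moreover have "Re z - a = 2 * d" by (simp add: d_def)
    ultimately show ?thesis by (simp add: abs_le_iff)
  qed
  define M where "M = (\<lambda>n. K (norm z + d) * real (Suc n) powr (-d - 1))"
  have "summable M"
    unfolding M_def using d summable_real_powr_iff[of "-d - 1"]
    by (intro summable_mult) (subst summable_Suc_iff, simp)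
  moreover have "norm (f n w) \<le> M n" if w: "w \<in> cball z d" for n w
  proof -
    have "norm (f n w) \<le> K (norm w) * real (Suc n) powr (a - Re w - 1)"
      using Re[OF w] d by (intro bound) auto
    also have "\<dots> \<le> M n"
      unfolding M_def
    proof (rule mult_mono)
      have "norm w \<le> norm z + d"
        using w norm_triangle_ineq2[of w z] by (simp add: dist_norm norm_minus_commute)
      thus "K (norm w) \<le> K (norm z + d)" by (intro K) auto
    qed (use Re[OF w] d in \<open>auto intro!: powr_mono K\<close>)
    finally show ?thesis .
  qed
  moreover have "cball z d \<subseteq> {s. Re s > a}"
    using Re d by force
  ultimately show ?thesis using d that by blast
qed

lemma summable_halfplane:
  fixes f :: "nat \<Rightarrow> complex \<Rightarrow> complex" and K :: "real \<Rightarrow> real"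
  assumes bound: "\<And>n s. Re s > a \<Longrightarrow> norm (f n s) \<le> K (norm s) * real (Suc n) powr (a - Re s - 1)"
  assumes K: "\<And>t. t \<ge> 0 \<Longrightarrow> K t \<ge> 0" "\<And>t u. 0 \<le> t \<Longrightarrow> t \<le> u \<Longrightarrow> K t \<le> K u"
  assumes z: "Re z > a"
  shows "summable (\<lambda>n. f n z)"
proof -
  obtain d M where d: "d > 0" "cball z d \<subseteq> {s. Re s > a}" and M: "summable M"
      "\<And>n w. w \<in> cball z d \<Longrightarrow> norm (f n w) \<le> M n"
    using halfplane_dominated[of a f K z, OF bound K z] by metis
  have "norm (f n z) \<le> M n" for n
    using d by (intro M(2)) simp
  with M(1) show ?thesis
    by (rule summable_comparison_test')
qed

lemma holomorphic_suminf_halfplane: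
  fixes f :: "nat \<Rightarrow> complex \<Rightarrow> complex" and K :: "real \<Rightarrow> real"
  assumes bound: "\<And>n s. Re s > a \<Longrightarrow> norm (f n s) \<le> K (norm s) * real (Suc n) powr (a - Re s - 1)"
  assumes K: "\<And>t. t \<ge> 0 \<Longrightarrow> K t \<ge> 0" "\<And>t u. 0 \<le> t \<Longrightarrow> t \<le> u \<Longrightarrow> K t \<le> K u"
  assumes hol: "\<And>n. f n holomorphic_on UNIV"
  shows "(\<lambda>s. \<Sum>n. f n s) holomorphic_on {s. Re s > a}"
proof (rule holomorphic_uniform_sequence)
  show "open {s. Re s > a}" by (rule open_halfspace_Re_gt)
  show "(\<lambda>s. \<Sum>n<N. f n s) holomorphic_on {s. Re s > a}" for N
    using hol by (intro holomorphic_intros) (auto intro: holomorphic_on_subset)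
  fix z assume "z \<in> {s. Re s > a}"
  hence z: "Re z > a" by simp
  obtain d M where d: "d > 0" "cball z d \<subseteq> {s. Re s > a}" and M: "summable M"
      "\<And>n w. w \<in> cball z d \<Longrightarrow> norm (f n w) \<le> M n"
    using halfplane_dominated[of a f K z, OF bound K z] by metis
  have "uniform_limit (cball z d) (\<lambda>N s. \<Sum>n<N. f n s) (\<lambda>s. \<Sum>n. f n s) sequentially"
    using M(2,1) by (rule Weierstrass_m_test)
  with d show "\<exists>d>0. cball z d \<subseteq> {s. Re s > a} \<and>
          uniform_limit (cball z d) (\<lambda>N s. \<Sum>n<N. f n s) (\<lambda>s. \<Sum>n. f n s) sequentially"
    by blast
qed

section \<open>Iterated differences of powers and the Dirichlet eta function\<close>

text \<open>The sign of the difference is chosen so that adding neighbouring terms of an alternating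
  series produces the next difference.\<close>

primrec diff_powr :: "nat \<Rightarrow> complex \<Rightarrow> complex \<Rightarrow> complex" where
  "diff_powr 0 s z = z powr (-s)"
| "diff_powr (Suc m) s z = diff_powr m s z - diff_powr m s (z + 1)"

text \<open>Differentiation commutes with taking differences, so only the case of a single power
  matters; it shifts \<open>s\<close> to \<open>s + 1\<close>.\<close>

lemma diff_powr_deriv:
  assumes "Re z > 0"
  shows   "(diff_powr m s has_field_derivative -s * diff_powr m (s + 1) z) (at z)"
  using assms
proof (induction m arbitrary: z)
  case 0
  hence "z \<notin> \<real>\<^sub>\<le>\<^sub>0" by (auto simp: complex_nonpos_Reals_iff)
  moreover have "- s - 1 = - (s + 1)" by simp
  ultimately show ?case
    using has_field_derivative_powr[of z "-s"] by (metis diff_powr.simps(1) ext)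
next
  case (Suc m)
  have "((\<lambda>z. diff_powr m s (z + 1)) has_field_derivative -s * diff_powr m (s + 1) (z + 1)) (at z)"
    using Suc.IH[of "z + 1"] Suc.prems by (intro DERIV_shift [THEN iffD1]) simp_all
  from DERIV_diff[OF Suc.IH[OF Suc.prems] this] show ?case
    by (simp add: algebra_simps)
qed

lemma diff_powr_holomorphic:
  assumes "Re z > 0"
  shows   "(\<lambda>s. diff_powr m s z) holomorphic_on UNIV"
  using assms
proof (induction m arbitrary: z)
  case 0
  thus ?case by (auto intro!: holomorphic_intros)
next
  case (Suc m)
  thus ?case by (auto intro!: holomorphic_intros)
qed

lemma of_real_segment:
  assumes "z \<in> closed_segment (of_real a) (of_real b)" "a \<le> b"
  obtains y where "z = of_real y" "a \<le> y" "y \<le> b"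
  using assms by (auto simp: closed_segment_of_real closed_segment_eq_real_ivl)

text \<open>By the mean value inequality on the segment from \<open>x\<close> to
  \<open>x + 1\<close>, each difference costs one derivative, that is, a factor
  \<open>norm s\<close> and one power of decay. The condition on \<open>Re s\<close> makes the
  exponent nonpositive, so the left endpoint dominates the segment.\<close>

lemma norm_diff_powr_le:
  assumes "x > 0" "Re s + real m \<ge> 0"
  shows   "norm (diff_powr m s (of_real x)) \<le> (norm s + real m) ^ m * x powr (- Re s - real m)"
  using assms
proof (induction m arbitrary: s x)
  case 0
  thus ?case by (simp add: norm_powr_real_powr)
next
  case (Suc m)
  have "norm (diff_powr m s (of_real x) - diff_powr m s (of_real (x + 1))) \<le>
          (norm s * (norm (s + 1) + real m) ^ m * x powr (- Re s - 1 - real m)) *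
          norm (of_real x - of_real (x + 1) :: complex)"
  proof (rule field_differentiable_bound
      [where S = "closed_segment (of_real x) (of_real (x + 1))" and f = "diff_powr m s" and
         f' = "\<lambda>z. -s * diff_powr m (s + 1) z"])
    fix z :: complex assume "z \<in> closed_segment (of_real x) (of_real (x + 1))"
    then obtain y where y: "z = of_real y" "x \<le> y" "y \<le> x + 1"
      by (rule of_real_segment) simp
    show "(diff_powr m s has_field_derivative -s * diff_powr m (s + 1) z)
            (at z within closed_segment (of_real x) (of_real (x + 1)))"
    proof (rule has_field_derivative_at_within, rule diff_powr_deriv)
      show "Re z > 0" using y Suc.prems(1) by simp
    qed
    have "norm (diff_powr m (s + 1) z) \<le>
            (norm (s + 1) + real m) ^ m * y powr (- Re (s + 1) - real m)"
      unfolding y(1) using y Suc.prems by (intro Suc.IH) auto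
    also have "\<dots> \<le> (norm (s + 1) + real m) ^ m * x powr (- Re (s + 1) - real m)"
      using y Suc.prems by (intro mult_left_mono powr_mono2') auto
    finally show "norm (-s * diff_powr m (s + 1) z) \<le>
        norm s * (norm (s + 1) + real m) ^ m * x powr (- Re s - 1 - real m)"
      by (simp add: norm_mult mult.assoc mult_left_mono)
  qed auto
  also have "\<dots> = norm s * (norm (s + 1) + real m) ^ m * x powr (- Re s - real (Suc m))"
    by (simp add: algebra_simps)
  also have "\<dots> \<le> (norm s + real (Suc m)) ^ Suc m * x powr (- Re s - real (Suc m))"
  proof (intro mult_right_mono)
    have "norm (s + 1) + real m \<le> norm s + real (Suc m)"
      using norm_triangle_ineq[of s 1] by simp
    thus "norm s * (norm (s + 1) + real m) ^ m \<le> (norm s + real (Suc m)) ^ Suc m"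
      unfolding power_Suc by (intro mult_mono power_mono) auto
  qed auto
  finally show ?case by simp
qed

definition eta_tail :: "nat \<Rightarrow> nat \<Rightarrow> complex \<Rightarrow> complex" where
  "eta_tail m n s = (-1) ^ n * diff_powr m s (of_nat (Suc n))"

text \<open>The exponent is arranged to match the half-plane lemmas with
  \<open>a = 1 - real m\<close>.\<close>

lemma norm_eta_tail_le:
  assumes "Re s > 1 - real m"
  shows   "norm (eta_tail m n s) \<le> (norm s + real m) ^ m * real (Suc n) powr ((1 - real m) - Re s - 1)"
proof -
  have "norm (diff_powr m s (of_real (real (Suc n)))) \<le>
          (norm s + real m) ^ m * real (Suc n) powr (- Re s - real m)"
    using assms by (intro norm_diff_powr_le) auto
  thus ?thesis by (simp add: eta_tail_def norm_mult norm_power algebra_simps)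
qed

lemma summable_eta_tail:
  assumes "Re s > 1 - real m"
  shows   "summable (\<lambda>n. eta_tail m n s)"
  by (rule summable_halfplane[where K = "\<lambda>t. (t + real m) ^ m", OF norm_eta_tail_le])
     (use assms in \<open>auto intro: power_mono\<close>)

text \<open>Euler's transformation of the alternating series \<open>\<Sum>n. (-1) ^ n * (n + 1) powr (-s)\<close>: each of the
  \<open>m\<close> averaging steps replaces the summand by half its forward difference and so gains one power
  of decay. The value does not depend on \<open>m\<close>, only the half-plane of convergence does.\<close>

definition eta_approx :: "nat \<Rightarrow> complex \<Rightarrow> complex" where
  "eta_approx m s = (\<Sum>j<m. diff_powr j s 1 / 2 ^ Suc j) + (\<Sum>n. eta_tail m n s) / 2 ^ m"

lemma eta_approx_holomorphic: "eta_approx m holomorphic_on {s. Re s > 1 - real m}"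
proof -
  have "(\<lambda>s. \<Sum>n. eta_tail m n s) holomorphic_on {s. Re s > 1 - real m}"
  proof (rule holomorphic_suminf_halfplane[where K = "\<lambda>t. (t + real m) ^ m", OF norm_eta_tail_le])
    show "eta_tail m n holomorphic_on UNIV" for n
      unfolding eta_tail_def by (intro holomorphic_intros diff_powr_holomorphic) auto
  qed (auto intro: power_mono)
  moreover have "(\<lambda>s. diff_powr j s 1) holomorphic_on {s. Re s > 1 - real m}" for j
    using diff_powr_holomorphic[of 1 j] by (auto intro: holomorphic_on_subset)
  ultimately show ?thesis
    unfolding eta_approx_def by (intro holomorphic_intros) auto
qed

text \<open>If \<open>A\<close> is the tail sum, adding the series to its own shift gives twice
  \<open>A\<close> minus the first term, and termwise it gives the next tail. Dividing by
  \<open>2 ^ Suc m\<close> moves exactly that first term into the finite sum.\<close>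

lemma eta_approx_Suc:
  assumes "Re s > 1 - real m"
  shows   "eta_approx (Suc m) s = eta_approx m s"
proof -
  define A where "A = (\<Sum>n. eta_tail m n s)"
  have A: "(\<lambda>n. eta_tail m n s) sums A"
    using summable_eta_tail[OF assms] by (simp add: A_def summable_sums)
  hence "(\<lambda>n. eta_tail m (Suc n) s) sums (A - eta_tail m 0 s)"
    by (subst sums_Suc_iff) simp
  from sums_add[OF A this]
  have "(\<lambda>n. eta_tail m n s + eta_tail m (Suc n) s) sums (2 * A - diff_powr m s 1)"
    by (simp add: eta_tail_def)
  also have "(\<lambda>n. eta_tail m n s + eta_tail m (Suc n) s) = (\<lambda>n. eta_tail (Suc m) n s)"
    by (simp add: eta_tail_def algebra_simps)
  finally have "(\<Sum>n. eta_tail (Suc m) n s) = 2 * A - diff_powr m s 1"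
    by (simp add: sums_iff)
  hence "(\<Sum>n. eta_tail (Suc m) n s) / 2 ^ Suc m = A / 2 ^ m - diff_powr m s 1 / 2 ^ Suc m"
    by (simp add: diff_divide_distrib)
  thus ?thesis
    by (simp add: eta_approx_def A_def)
qed

lemma eta_approx_eq:
  assumes "Re s > 1 - real m" "m \<le> k"
  shows   "eta_approx k s = eta_approx m s"
  using assms(2)
proof (induction k rule: dec_induct)
  case (step k)
  thus ?case using assms by (simp add: eta_approx_Suc)
qed simp

text \<open>The number of steps \<open>m\<close> is chosen so that \<open>1 - real m < Re s\<close>;
  by \<open>eta_approx_eq\<close> every other \<open>m\<close> with this property gives the same
  value.\<close>

definition dirichlet_eta :: "complex \<Rightarrow> complex" where
  "dirichlet_eta s = eta_approx (nat \<lceil>2 - Re s\<rceil>) s"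

lemma dirichlet_eta_eq:
  assumes "Re s > 1 - real m"
  shows   "dirichlet_eta s = eta_approx m s"
proof -
  have "Re s > 1 - real (nat \<lceil>2 - Re s\<rceil>)"
    by linarith
  with assms show ?thesis
    unfolding dirichlet_eta_def by (metis eta_approx_eq nat_le_linear)
qed

lemma dirichlet_eta_holomorphic: "dirichlet_eta holomorphic_on UNIV"
proof -
  have "dirichlet_eta holomorphic_on (\<Union>m. {s. Re s > 1 - real m})"
  proof (rule holomorphic_on_UN_open)
    show "dirichlet_eta holomorphic_on {s. Re s > 1 - real m}" for m
      using eta_approx_holomorphic[of m] dirichlet_eta_eq[of m]
      by (subst holomorphic_cong[OF refl, of _ _ "eta_approx m"]) auto
  qed (rule open_halfspace_Re_gt)
  also have "(\<Union>m. {s. Re s > 1 - real m}) = UNIV"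
  proof safe
    fix s :: complex
    obtain m where "real m > 1 - Re s" using reals_Archimedean2 by blast
    thus "s \<in> (\<Union>m. {s. Re s > 1 - real m})" by (auto intro!: exI[of _ m])
  qed auto
  finally show ?thesis .
qed

section \<open>The function (s - 1) zeta(s) on the right half-plane\<close>

text \<open>This is \<open>s - 1\<close> times the difference between
  \<open>of_nat (n + 2) powr (-s)\<close> and the integral of \<open>x powr (-s)\<close> from
  \<open>n + 1\<close> to \<open>n + 2\<close>. Multiplying the integral out keeps the formula
  meaningful at \<open>s = 1\<close>.\<close>

definition zeta_term :: "nat \<Rightarrow> complex \<Rightarrow> complex" where
  "zeta_term n s = (s - 1) * of_nat (n + 2) powr (-s) + of_nat (n + 2) powr (1 - s) -
     of_nat (n + 1) powr (1 - s)"

text \<open>The mean value inequality is used twice: once for the variation of the power on the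
  segment, giving \<open>B\<close>, and once for an antiderivative of that variation.\<close>

lemma norm_zeta_term_le:
  assumes "Re s > 0"
  shows   "norm (zeta_term n s) \<le> (norm s + 1) * norm s * real (Suc n) powr (0 - Re s - 1)"
proof -
  define a b where "a = real (n + 1)" and "b = real (n + 2)"
  have ab: "a > 0" "a \<le> b" "b - a = 1" by (auto simp: a_def b_def)
  define S where "S = closed_segment (complex_of_real a) (of_real b)"
  define B where "B = norm s * a powr (- Re s - 1)"
  have inner: "norm (z powr (-s) - of_real b powr (-s)) \<le> B" if z: "z \<in> S" for z
  proof -
    have "norm (z powr (-s) - of_real b powr (-s)) \<le> B * norm (z - of_real b)"
    proof (rule field_differentiable_bound
        [where S = S and f = "\<lambda>z. z powr (-s)" and f' = "\<lambda>w. -s * w powr (-s - 1)"])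
      fix w assume "w \<in> S"
      then obtain y where y: "w = of_real y" "a \<le> y" "y \<le> b"
        unfolding S_def using ab by (auto elim: of_real_segment)
      show "((\<lambda>z. z powr (-s)) has_field_derivative -s * w powr (-s - 1)) (at w within S)"
        using y ab by (intro has_field_derivative_at_within[OF has_field_derivative_powr]) auto
      have "y powr (- Re s - 1) \<le> a powr (- Re s - 1)"
        using y ab assms by (intro powr_mono2') auto
      thus "norm (-s * w powr (-s - 1)) \<le> B"
        using y ab by (auto simp: norm_mult norm_powr_real_powr B_def intro: mult_left_mono)
    qed (use z in \<open>auto simp: S_def\<close>)
    also have "\<dots> \<le> B * 1"
    proof (rule mult_left_mono)
      show "norm (z - of_real b) \<le> 1"
        using z ab unfolding S_def by (auto elim!: of_real_segment simp flip: of_real_diff)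
    qed (simp add: B_def)
    finally show ?thesis by simp
  qed
  \<comment> \<open>An antiderivative of
    \<open>(1 - s) * (z powr (-s) - of_real b powr (-s))\<close>, whose increment from
    \<open>a\<close> to \<open>b\<close> is the term to be bounded.\<close>
  define \<phi> where "\<phi> = (\<lambda>z. z powr (1 - s) + (s - 1) * z * of_real b powr (-s))"
  have "norm (\<phi> (of_real b) - \<phi> (of_real a)) \<le>
          norm (1 - s) * B * norm (complex_of_real b - of_real a)"
  proof (rule field_differentiable_bound
      [where S = S and f = \<phi> and f' = "\<lambda>w. (1 - s) * (w powr (-s) - of_real b powr (-s))"])
    fix w assume w: "w \<in> S"
    then obtain y where y: "w = of_real y" "a \<le> y" "y \<le> b"
      unfolding S_def using ab by (auto elim: of_real_segment)
    hence "w \<notin> \<real>\<^sub>\<le>\<^sub>0" using ab by auto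
    thus "(\<phi> has_field_derivative (1 - s) * (w powr (-s) - of_real b powr (-s))) (at w within S)"
      unfolding \<phi>_def
      by (auto intro!: derivative_eq_intros has_field_derivative_at_within[OF has_field_derivative_powr]
               simp: algebra_simps)
    show "norm ((1 - s) * (w powr (-s) - of_real b powr (-s))) \<le> norm (1 - s) * B"
      using inner[OF w] by (simp add: norm_mult mult_left_mono)
  qed (auto simp: S_def)
  also have "\<phi> (of_real b) - \<phi> (of_real a) = zeta_term n s"
  proof -
    have "of_real b = of_real a + (1::complex)" using ab by (simp add: a_def b_def)
    hence "(s - 1) * of_real b * of_real b powr (-s) - (s - 1) * of_real a * of_real b powr (-s) =
             (s - 1) * of_real b powr (-s)"
      by (simp add: algebra_simps)
    thus ?thesis by (simp add: \<phi>_def zeta_term_def a_def b_def algebra_simps)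
  qed
  also have "norm (complex_of_real b - of_real a) = 1"
    using ab by (simp flip: of_real_diff)
  also have "norm (1 - s) * B * 1 \<le> (norm s + 1) * B"
    using norm_triangle_ineq4[of 1 s] by (auto simp: B_def intro!: mult_right_mono)
  finally show ?thesis by (simp add: B_def a_def mult.assoc)
qed

lemma summable_zeta_term: "Re s > 0 \<Longrightarrow> summable (\<lambda>n. zeta_term n s)"
  by (rule summable_halfplane[where K = "\<lambda>t. (t + 1) * t", OF norm_zeta_term_le])
     (auto intro!: mult_mono)

text \<open>The function \<open>(s - 1) \<zeta>(s)\<close> for \<open>Re s > 0\<close>: the partial sums telescope, see \<open>sum_zeta_term\<close>.\<close>

definition zeta_right :: "complex \<Rightarrow> complex" where
  "zeta_right s = s + (\<Sum>n. zeta_term n s)"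

lemma zeta_right_holomorphic: "zeta_right holomorphic_on {s. Re s > 0}"
proof -
  have "(\<lambda>s. \<Sum>n. zeta_term n s) holomorphic_on {s. Re s > 0}"
  proof (rule holomorphic_suminf_halfplane[where K = "\<lambda>t. (t + 1) * t", OF norm_zeta_term_le])
    have "complex_of_nat (n + 2) \<noteq> 0" "complex_of_nat (n + 1) \<noteq> 0" for n
      unfolding of_nat_eq_0_iff by auto
    thus "zeta_term n holomorphic_on UNIV" for n
      unfolding zeta_term_def by (intro holomorphic_intros)
  qed (auto intro!: mult_mono)
  thus ?thesis unfolding zeta_right_def by (intro holomorphic_intros)
qed

lemma sum_zeta_term:
  "s + (\<Sum>n<N. zeta_term n s) =
     (s - 1) * (\<Sum>n=1..Suc N. of_nat n powr (-s)) + of_nat (Suc N) powr (1 - s)"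
  by (induction N) (simp_all add: zeta_term_def algebra_simps)

lemma tendsto_zeta_right:
  assumes "Re s > 1"
  shows   "(\<lambda>N. \<Sum>n=1..N. of_nat n powr (-s)) \<longlonglongrightarrow> zeta_right s / (s - 1)"
proof -
  have "(\<lambda>N. s + (\<Sum>n<N. zeta_term n s)) \<longlonglongrightarrow> zeta_right s"
    unfolding zeta_right_def using assms
    by (intro tendsto_intros summable_LIMSEQ summable_zeta_term) auto
  moreover have "(\<lambda>N. of_nat (Suc N) powr (1 - s)) \<longlonglongrightarrow> 0"
  proof (rule Lim_null_comparison[OF always_eventually])
    show "\<forall>N. norm (of_nat (Suc N) powr (1 - s)) \<le> real (Suc N) powr (1 - Re s)"
      using norm_powr_real_powr[of "of_nat (Suc N)" "1 - s" for N] by simp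
    have "filterlim (\<lambda>N. real (Suc N)) at_top sequentially"
      using filterlim_compose[OF filterlim_real_sequentially filterlim_Suc] by simp
    thus "(\<lambda>N. real (Suc N) powr (1 - Re s)) \<longlonglongrightarrow> 0"
      using assms by (intro tendsto_neg_powr) auto
  qed
  ultimately have "(\<lambda>N. (s + (\<Sum>n<N. zeta_term n s) - of_nat (Suc N) powr (1 - s)) / (s - 1))
                     \<longlonglongrightarrow> (zeta_right s - 0) / (s - 1)"
    using assms by (intro tendsto_intros) auto
  moreover have "(s + (\<Sum>n<N. zeta_term n s) - of_nat (Suc N) powr (1 - s)) / (s - 1) =
                   (\<Sum>n=1..Suc N. of_nat n powr (-s))" for N
  proof -
    have "s \<noteq> 1" using assms by auto
    thus ?thesis unfolding sum_zeta_term by simp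
  qed
  ultimately have "(\<lambda>N. \<Sum>n=1..Suc N. of_nat n powr (-s)) \<longlonglongrightarrow> zeta_right s / (s - 1)"
    by (simp del: sum.cl_ivl_Suc of_nat_Suc)
  thus ?thesis by (rule LIMSEQ_imp_Suc)
qed

section \<open>Gluing the two continuations to an entire function\<close>

text \<open>For \<open>Re s > 1\<close> this is a rearrangement of the series, and the identity
  theorem extends it. The factor \<open>s - 1\<close> keeps both sides holomorphic at 1.\<close>

lemma dirichlet_eta_eq_zeta_right:
  assumes "Re s > 0"
  shows   "(1 - 2 powr (1 - s)) * zeta_right s = (s - 1) * dirichlet_eta s"
proof (rule analytic_continuation_open[where s = "{s. Re s > 1}" and s' = "{s. Re s > 0}" and
    f = "\<lambda>s. (1 - 2 powr (1 - s)) * zeta_right s" and g = "\<lambda>s. (s - 1) * dirichlet_eta s"])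
  show "connected {s. Re s > 0}"
    by (intro convex_connected convex_halfspace_Re_gt)
  have "(2 :: complex) \<in> {s. Re s > 1}" by simp
  thus "{s :: complex. Re s > 1} \<noteq> {}" by blast
  show "(\<lambda>s. (1 - 2 powr (1 - s)) * zeta_right s) holomorphic_on {s. Re s > 0}"
    by (intro holomorphic_intros zeta_right_holomorphic) auto
  show "(\<lambda>s. (s - 1) * dirichlet_eta s) holomorphic_on {s. Re s > 0}"
    using dirichlet_eta_holomorphic by (intro holomorphic_intros) (auto intro: holomorphic_on_subset)
next
  fix s :: complex assume "s \<in> {s. Re s > 1}"
  hence s: "Re s > 1" by simp
  hence "s \<noteq> 1" by auto
  define H where "H = (\<lambda>N. \<Sum>n=1..N. complex_of_nat n powr (-s))"
  have H: "H \<longlonglongrightarrow> zeta_right s / (s - 1)"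
    unfolding H_def using s by (rule tendsto_zeta_right)
  have "(\<lambda>N. \<Sum>n<N. eta_tail 0 n s) \<longlonglongrightarrow> (\<Sum>n. eta_tail 0 n s)"
    using s by (intro summable_LIMSEQ summable_eta_tail) auto
  also have "(\<Sum>n. eta_tail 0 n s) = dirichlet_eta s"
    using s by (simp add: dirichlet_eta_eq[of 0] eta_approx_def)
  finally have "(\<lambda>N. \<Sum>n<2*N. eta_tail 0 n s) \<longlonglongrightarrow> dirichlet_eta s"
    by (rule filterlim_compose) (rule mult_nat_left_at_top, simp)
  \<comment> \<open>The alternating sum is the full sum minus twice the terms with even base, and
    these carry a common factor \<open>2 powr (-s)\<close>.\<close>
  also have "(\<lambda>N. \<Sum>n<2*N. eta_tail 0 n s) = (\<lambda>N. H (2 * N) - 2 powr (1 - s) * H N)"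
  proof
    fix N
    have "2 powr (1 - s) = 2 * 2 powr (-s)"
      by (simp add: powr_diff powr_minus field_simps)
    moreover have "of_nat (2 * Suc N) powr (-s) = 2 powr (-s) * of_nat (Suc N) powr (-s)" for N
      unfolding of_nat_mult of_nat_numeral by (subst powr_times_real) auto
    ultimately show "(\<Sum>n<2*N. eta_tail 0 n s) = H (2 * N) - 2 powr (1 - s) * H N"
      by (induction N) (simp_all add: H_def eta_tail_def algebra_simps)
  qed
  finally have "(\<lambda>N. H (2 * N) - 2 powr (1 - s) * H N) \<longlonglongrightarrow> dirichlet_eta s" .
  moreover have "(\<lambda>N. H (2 * N)) \<longlonglongrightarrow> zeta_right s / (s - 1)"
    by (rule filterlim_compose[OF H mult_nat_left_at_top]) simp
  hence "(\<lambda>N. H (2 * N) - 2 powr (1 - s) * H N) \<longlonglongrightarrow>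
           zeta_right s / (s - 1) - 2 powr (1 - s) * (zeta_right s / (s - 1))"
    by (intro tendsto_intros H)
  ultimately have "dirichlet_eta s = zeta_right s / (s - 1) - 2 powr (1 - s) * (zeta_right s / (s - 1))"
    by (rule LIMSEQ_unique)
  also have "\<dots> = (1 - 2 powr (1 - s)) * zeta_right s / (s - 1)"
    by (simp add: left_diff_distrib diff_divide_distrib)
  finally show "(1 - 2 powr (1 - s)) * zeta_right s = (s - 1) * dirichlet_eta s"
    using \<open>s \<noteq> 1\<close> by simp
qed (use assms in \<open>auto intro: open_halfspace_Re_gt\<close>)

text \<open>The entire function \<open>(s - 1) \<zeta>(s)\<close>. All zeros of \<open>1 - 2 powr (1 - s)\<close> lie on the line
  \<open>Re s = 1\<close>, so the second branch never divides by zero.\<close>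

definition zeta_entire :: "complex \<Rightarrow> complex" where
  "zeta_entire s = (if s \<in> {s. Re s > 0} then zeta_right s
                    else (s - 1) * dirichlet_eta s / (1 - 2 powr (1 - s)))"

text \<open>The half-planes \<open>Re s > 0\<close> and \<open>Re s < 1\<close> cover the plane, and
  the two formulas agree on their overlap.\<close>

lemma zeta_entire_holomorphic: "zeta_entire holomorphic_on UNIV"
proof -
  have nz: "1 - 2 powr (1 - s) \<noteq> 0" if "Re s < 1" for s :: complex
  proof
    assume "1 - 2 powr (1 - s) = 0"
    hence "norm (2 powr (1 - s)) = 1" by simp
    hence "2 powr (1 - Re s) = 1"
      by (subst (asm) norm_powr_real_powr) auto
    moreover have "2 powr (1 - Re s) > 2 powr 0"
      using that by (intro powr_less_mono) auto
    ultimately show False by simp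
  qed
  have "zeta_entire holomorphic_on {s. Re s > 0} \<union> {s. Re s < 1}"
    unfolding zeta_entire_def
  proof (rule holomorphic_on_If_Un)
    show "(\<lambda>s. (s - 1) * dirichlet_eta s / (1 - 2 powr (1 - s))) holomorphic_on {s. Re s < 1}"
      using dirichlet_eta_holomorphic nz
      by (intro holomorphic_intros) (auto intro: holomorphic_on_subset)
    show "zeta_right s = (s - 1) * dirichlet_eta s / (1 - 2 powr (1 - s))"
      if "s \<in> {s. Re s > 0}" "s \<in> {s. Re s < 1}" for s
      using that dirichlet_eta_eq_zeta_right[of s] nz[of s] by (simp add: field_simps)
  qed (auto intro: zeta_right_holomorphic open_halfspace_Re_gt open_halfspace_Re_lt)
  also have "{s. Re s > 0} \<union> {s. Re s < 1} = UNIV" by auto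
  finally show ?thesis .
qed

lemma zeta_entire_1: "zeta_entire 1 = 1"
proof -
  have "zeta_term n 1 = 0" for n
  proof -
    have "complex_of_nat (n + 2) \<noteq> 0" "complex_of_nat (n + 1) \<noteq> 0"
      unfolding of_nat_eq_0_iff by auto
    thus ?thesis by (simp add: zeta_term_def)
  qed
  thus ?thesis by (simp add: zeta_entire_def zeta_right_def)
qed

text \<open>For real \<open>x\<close> in this interval \<open>t powr (-x)\<close> is decreasing in
  \<open>t\<close>, so its integral over a unit interval exceeds the value at the right endpoint.
  After multiplication by the negative \<open>x - 1\<close> every term of the series is nonnegative,
  and the summand \<open>x\<close> gives strict positivity.\<close>

lemma zeta_entire_pos:
  assumes "0 < x" "x < 1"
  obtains y where "y > 0" "zeta_entire (of_real x) = of_real y"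
proof -
  define t where "t = (\<lambda>n. (x - 1) * real (n + 2) powr (-x) + real (n + 2) powr (1 - x) -
     real (n + 1) powr (1 - x))"
  have t: "zeta_term n (of_real x) = of_real (t n)" for n
    using powr_of_real[of "real (n + 2)" "-x"] powr_of_real[of "real (n + 2)" "1 - x"]
          powr_of_real[of "real (n + 1)" "1 - x"]
    by (simp add: zeta_term_def t_def)
  have "t n \<ge> 0" for n
  proof -
    have "\<exists>z. real (n + 1) < z \<and> z < real (n + 2) \<and>
            real (n + 2) powr (1 - x) - real (n + 1) powr (1 - x) =
              (real (n + 2) - real (n + 1)) * ((1 - x) * z powr (-x))"
      by (intro MVT2) (auto intro!: derivative_eq_intros)
    then obtain z where z: "real (n + 1) < z" "z < real (n + 2)"
      "real (n + 2) powr (1 - x) - real (n + 1) powr (1 - x) = (1 - x) * z powr (-x)"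
      by auto
    have "real (n + 2) powr (-x) \<le> z powr (-x)"
      using z assms by (intro powr_mono2') auto
    hence "(1 - x) * real (n + 2) powr (-x) \<le> (1 - x) * z powr (-x)"
      using assms by (intro mult_left_mono) auto
    thus ?thesis using z(3) unfolding t_def by (simp add: algebra_simps)
  qed
  moreover have "summable t"
    using summable_zeta_term[of "of_real x"] assms by (simp add: t summable_of_real_iff)
  ultimately have "x + suminf t > 0"
    using assms by (intro add_pos_nonneg suminf_nonneg) auto
  moreover have "zeta_entire (of_real x) = of_real (x + suminf t)"
    using assms \<open>summable t\<close> by (simp add: zeta_entire_def zeta_right_def t suminf_of_real)
  ultimately show ?thesis using that by blast
qed

section \<open>Zeta itself: its pole at 1 and its sign between 0 and 1\<close>

text \<open>At \<open>s = 1\<close> the value is the default 0 of division by zero; the pole is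
  captured by a punctured limit in \<open>riemann_zeta_pole\<close>.\<close>

definition riemann_zeta :: "complex \<Rightarrow> complex" where
  "riemann_zeta s = zeta_entire s / (s - 1)"

lemma riemann_zeta_tendsto:
  assumes "Re s > 1"
  shows   "(\<lambda>N. \<Sum>n=1..N. of_nat n powr (-s)) \<longlonglongrightarrow> riemann_zeta s"
  using tendsto_zeta_right[OF assms] assms by (simp add: riemann_zeta_def zeta_entire_def)

lemma riemann_zeta_holomorphic: "riemann_zeta holomorphic_on -{1}"
  unfolding riemann_zeta_def using zeta_entire_holomorphic
  by (intro holomorphic_intros) (auto intro: holomorphic_on_subset)

lemma riemann_zeta_meromorphic: "riemann_zeta meromorphic_on UNIV"
  unfolding riemann_zeta_def using zeta_entire_holomorphic
  by (intro meromorphic_intros analytic_on_imp_meromorphic_on) (simp_all add: analytic_on_open)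

lemma riemann_zeta_pole: "((\<lambda>s. (s - 1) * riemann_zeta s) \<longlongrightarrow> 1) (at 1)"
proof -
  have "zeta_entire \<midarrow>1\<rightarrow> zeta_entire 1"
    using zeta_entire_holomorphic holomorphic_on_imp_continuous_on
    by (metis continuous_on_def UNIV_I)
  moreover have "eventually (\<lambda>s. zeta_entire s = (s - 1) * riemann_zeta s) (at 1)"
    by (auto simp: eventually_at_filter riemann_zeta_def)
  ultimately show ?thesis
    using zeta_entire_1 by (simp add: tendsto_cong)
qed

lemma riemann_zeta_neg:
  assumes "0 < x" "x < 1"
  obtains y where "y < 0" "riemann_zeta (of_real x) = of_real y"
proof -
  from assms obtain y where y: "y > 0" "zeta_entire (of_real x) = of_real y"
    by (rule zeta_entire_pos)
  show ?thesis
  proof (rule that)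
    show "y / (x - 1) < 0" using y assms by (simp add: divide_pos_neg)
  qed (simp add: riemann_zeta_def y)
qed


section \<open>The Euler-Zagier zeta function\<close>

definition EZ_newton :: "nat \<Rightarrow> complex \<Rightarrow> complex" where
  "EZ_newton r s = newton_sym (\<lambda>j. riemann_zeta (of_nat j * s)) r"

lemma EZ_newton_0 [simp]: "EZ_newton 0 s = 1"
  by (simp add: EZ_newton_def)

lemma EZ_newton_Suc:
  "EZ_newton (Suc r) s =
     (\<Sum>i\<le>r. EZ_newton i s * ((-1) ^ (r - i) * riemann_zeta (of_nat (Suc (r - i)) * s))) /
       of_nat (Suc r)"
  by (simp add: EZ_newton_def)

lemma of_nat_prod_list_powr:
  "of_nat (prod_list ms) powr (s :: complex) = prod_list (map (\<lambda>n. of_nat n powr s) ms)"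
proof (induction ms)
  case (Cons m ms)
  have "(of_nat m * of_nat (prod_list ms)) powr s =
          of_nat m powr s * of_nat (prod_list ms) powr s"
    by (rule powr_times_real) auto
  thus ?case using Cons.IH by simp
qed simp

lemma EZ_series_eq_EZ_newton:
  assumes "Re s > 1"
  shows   "EZ_series r s = EZ_newton r s"
proof -
  define x where "x = (\<lambda>n. complex_of_nat n powr (-s))"
  have x_pow: "x n ^ j = of_nat n powr (-(of_nat j * s))" if "n \<ge> 1" for n j
    using that by (simp add: x_def powr_power)
  have x_norm: "complex_of_real (norm (x n) ^ j) = of_nat n powr (-(of_real (real j * Re s)))"
    if "n \<ge> 1" for n j
  proof -
    have "norm (x n) ^ j = real n powr (- (real j * Re s))"
      using that by (simp add: x_def norm_powr_real_powr powr_power)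
    also have "complex_of_real \<dots> = of_nat n powr (-(of_real (real j * Re s)))"
      using powr_of_real[of "real n" "- (real j * Re s)"] by simp
    finally show ?thesis .
  qed
  have gt1: "real j * Re s > 1" if "j \<ge> 1" for j
  proof -
    have "real j * 1 < real j * Re s"
      using that assms by (intro mult_strict_left_mono) auto
    moreover have "real j \<ge> 1" using that by simp
    ultimately show ?thesis by linarith
  qed
  have "EZ_series r s = (\<Sum>\<^sub>\<infinity>ms\<in>EZ_tuples r. prod_list (map x ms))"
    by (simp add: EZ_series_def x_def of_nat_prod_list_powr)
  also have "\<dots> = EZ_newton r s"
    unfolding EZ_newton_def
  proof (rule infsum_EZ_tuples)
    fix j :: nat assume j: "j \<ge> 1"
    have "(\<lambda>N. \<Sum>n=1..N. of_nat n powr (-(of_nat j * s))) \<longlonglongrightarrow> riemann_zeta (of_nat j * s)"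
      using gt1[OF j] by (intro riemann_zeta_tendsto) simp
    also have "(\<lambda>N. \<Sum>n=1..N. of_nat n powr (-(of_nat j * s))) = (\<lambda>N. \<Sum>n=1..N. x n ^ j)"
      by (intro ext sum.cong) (simp_all add: x_pow)
    finally show "(\<lambda>N. \<Sum>n=1..N. x n ^ j) \<longlonglongrightarrow> riemann_zeta (of_nat j * s)" .
    \<comment> \<open>The norms have power sums of the same shape at the real point
      \<open>real j * Re s\<close>; convergence is proved over the complex numbers and carried back
      by taking real parts.\<close>
    have "(\<lambda>N. \<Sum>n=1..N. of_nat n powr (-(of_real (real j * Re s)))) \<longlonglongrightarrow>
            riemann_zeta (of_real (real j * Re s))"
      using gt1[OF j] by (intro riemann_zeta_tendsto) simp
    also have "(\<lambda>N. \<Sum>n=1..N. of_nat n powr (-(of_real (real j * Re s)))) =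
                 (\<lambda>N. complex_of_real (\<Sum>n=1..N. norm (x n) ^ j))"
      unfolding of_real_sum by (intro ext sum.cong) (simp_all only: x_norm atLeastAtMost_iff)
    finally show "(\<lambda>N. \<Sum>n=1..N. norm (x n) ^ j) \<longlonglongrightarrow>
                    Re (riemann_zeta (of_real (real j * Re s)))"
      using tendsto_Re by fastforce
  qed
  finally show ?thesis .
qed

lemma riemann_zeta_scaled_analytic:
  assumes "of_nat j * s \<noteq> 1"
  shows   "(\<lambda>s. riemann_zeta (of_nat j * s)) analytic_on {s}"
proof -
  have "open {w :: complex. of_nat j * w \<noteq> 1}"
    by (intro open_Collect_neq continuous_intros)
  moreover have "(riemann_zeta \<circ> (\<lambda>s. of_nat j * s)) holomorphic_on {w. of_nat j * w \<noteq> 1}"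
    by (intro holomorphic_on_compose_gen[OF _ riemann_zeta_holomorphic] holomorphic_intros) auto
  ultimately have "(\<lambda>s. riemann_zeta (of_nat j * s)) analytic_on {w. of_nat j * w \<noteq> 1}"
    by (simp add: analytic_on_open o_def)
  thus ?thesis using assms by (rule_tac analytic_on_subset) auto
qed

lemma EZ_newton_meromorphic: "EZ_newton r meromorphic_on UNIV"
proof (induction r rule: less_induct)
  case (less r)
  have zeta: "(\<lambda>s. riemann_zeta (of_nat j * s)) meromorphic_on UNIV" for j
    by (rule meromorphic_on_compose[OF riemann_zeta_meromorphic]) (auto intro!: analytic_intros)
  show ?case
  proof (cases r)
    case 0
    hence "EZ_newton r = (\<lambda>_. 1)" by auto
    thus ?thesis by (simp add: meromorphic_on_const)
  next
    case (Suc q)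
    have "(\<lambda>s. EZ_newton (Suc q) s) meromorphic_on UNIV"
      unfolding EZ_newton_Suc using less.IH Suc by (intro meromorphic_intros zeta) auto
    thus ?thesis using Suc by simp
  qed
qed

lemma EZ_newton_analytic:
  assumes "\<And>k. 1 \<le> k \<Longrightarrow> k \<le> r \<Longrightarrow> of_nat k * s \<noteq> 1"
  shows   "EZ_newton r analytic_on {s}"
  using assms
proof (induction r rule: less_induct)
  case (less r)
  show ?case
  proof (cases r)
    case 0
    hence "EZ_newton r = (\<lambda>_. 1)" by auto
    thus ?thesis by simp
  next
    case (Suc q)
    have "(\<lambda>s. EZ_newton (Suc q) s) analytic_on {s}"
      unfolding EZ_newton_Suc
    proof (intro analytic_intros riemann_zeta_scaled_analytic)
      fix i assume "i \<in> {..q}"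
      thus "EZ_newton i analytic_on {s}"
        using less.IH[of i] less.prems Suc by auto
      show "of_nat (Suc (q - i)) * s \<noteq> 1"
        using Suc by (intro less.prems) auto
    qed (auto simp del: of_nat_Suc)
    thus ?thesis using Suc by simp
  qed
qed

text \<open>The recursion may leave arbitrary values at singular points; \<open>remove_sings\<close>
  normalises them as \<open>EZ_continuation\<close> demands. For \<open>Re s > 1\<close> no
  \<open>of_nat k * s\<close> with \<open>k\<close> positive equals 1, so nothing changes
  there.\<close>

lemma EZ_zeta_eq: "EZ_zeta r = remove_sings (EZ_newton r)"
proof (rule EZ_zeta_eqI)
  have "remove_sings (EZ_newton r) s = EZ_series r s" if s: "Re s > 1" for s
  proof -
    have "of_nat k * s \<noteq> 1" if "1 \<le> k" for k
    proof
      assume "of_nat k * s = 1"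
      from arg_cong[OF this, of Re] have "real k * Re s = 1" by simp
      moreover have "real k * Re s > real k * 1"
        using s that by (intro mult_strict_left_mono) auto
      ultimately show False using that by simp
    qed
    thus ?thesis using EZ_series_eq_EZ_newton[OF s] by (simp add: EZ_newton_analytic)
  qed
  thus "EZ_continuation r (remove_sings (EZ_newton r))"
    by (simp add: EZ_continuation_def remove_sings_nicely_meromorphic EZ_newton_meromorphic)
qed

section \<open>Leading behaviour at the points 1/k\<close>

text \<open>Of the \<open>r div k\<close> factors \<open>of_nat k * s - 1\<close>,
  \<open>i div k\<close> are absorbed by \<open>f\<close> and the rest go to the zeta factor.
  Extracting one common sign from every term leaves some \<open>D\<close> that is never negative,
  which later rules out cancellation.\<close>

lemma Newton_term_limit:
  assumes k: "k \<ge> 1" and j: "j \<ge> 1" "i + j = r" and "C > 0"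
  assumes lim: "((\<lambda>s. (of_nat k * s - 1) ^ (i div k) * f s) \<longlongrightarrow>
                   complex_of_real ((-1) ^ (i + i div k) * C)) (at (1 / of_nat k))"
  obtains D where "D \<ge> 0" "j = k \<or> j < k \<and> i div k = r div k \<Longrightarrow> D > 0"
    "((\<lambda>s. (of_nat k * s - 1) ^ (r div k) * (f s * ((-1) ^ (j - 1) * riemann_zeta (of_nat j * s)))) \<longlongrightarrow>
        complex_of_real ((-1) ^ (r + r div k) * D)) (at (1 / of_nat k))"
proof -
  note result = that
  define F where "F = at (1 / of_nat k :: complex)"
  define P Q where "P = i div k" and "Q = r div k"
  define g where "g = (\<lambda>s. (of_nat k * s - 1) ^ P * f s)"
  have g: "(g \<longlongrightarrow> of_real ((-1) ^ (i + P) * C)) F"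
    using lim by (simp add: g_def P_def F_def)
  have PQ: "P \<le> Q"
    unfolding P_def Q_def using j by (intro div_le_mono) auto
  have eq: "(of_nat k * s - 1) ^ Q * (f s * ((-1) ^ (j - 1) * riemann_zeta (of_nat j * s))) =
              (-1) ^ (j - 1) * g s * ((of_nat k * s - 1) ^ (Q - P) * riemann_zeta (of_nat j * s))" for s
  proof -
    have "(of_nat k * s - 1) ^ Q = (of_nat k * s - 1) ^ P * (of_nat k * s - 1) ^ (Q - P)"
      using PQ by (simp flip: power_add)
    thus ?thesis by (simp add: g_def mult_ac)
  qed
  \<comment> \<open>Common end of all cases: \<open>y\<close> is the limit of the zeta factor with
    its share of linear factors, \<open>z\<close> is what remains after extracting the sign, and
    \<open>D\<close> is \<open>z * C\<close>.\<close>
  have *: thesis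
    if "((\<lambda>s. (of_nat k * s - 1) ^ (Q - P) * riemann_zeta (of_nat j * s)) \<longlongrightarrow> of_real y) F"
       "(-1) ^ (j - 1) * (-1) ^ (i + P) * y = (-1) ^ (r + Q) * z"
       "z \<ge> 0" "j = k \<or> j < k \<and> P = Q \<Longrightarrow> z > 0" for y z :: real
  proof (rule result)
    have "((\<lambda>s. (-1) ^ (j - 1) * g s * ((of_nat k * s - 1) ^ (Q - P) * riemann_zeta (of_nat j * s)))
            \<longlongrightarrow> (-1) ^ (j - 1) * of_real ((-1) ^ (i + P) * C) * of_real y) F"
      by (intro tendsto_intros g that)
    also have "(-1) ^ (j - 1) * of_real ((-1) ^ (i + P) * C) * of_real y =
                 complex_of_real ((-1) ^ (j - 1) * (-1) ^ (i + P) * y * C)"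
      by simp
    finally show "((\<lambda>s. (of_nat k * s - 1) ^ (r div k) *
        (f s * ((-1) ^ (j - 1) * riemann_zeta (of_nat j * s)))) \<longlongrightarrow>
        complex_of_real ((-1) ^ (r + r div k) * (z * C))) (at (1 / of_nat k))"
      unfolding Q_def [symmetric] F_def [symmetric] eq that(2) by (simp add: mult.assoc)
  qed (use that \<open>C > 0\<close> in \<open>auto simp: P_def Q_def\<close>)
  have lin: "((\<lambda>s. of_nat k * s - 1) \<longlongrightarrow> (0::complex)) F"
    unfolding F_def using k by (auto intro!: tendsto_eq_intros)
  show thesis
  proof (cases "j = k")
    case True
    hence Q: "Q = Suc P"
      using j k by (auto simp: P_def Q_def)
    have "filterlim (\<lambda>s::complex. of_nat k * s) (at 1) F"
    proof (rule filterlim_atI)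
      show "((\<lambda>s. of_nat k * s) \<longlongrightarrow> (1::complex)) F"
        unfolding F_def using k by (auto intro!: tendsto_eq_intros)
      show "\<forall>\<^sub>F s in F. of_nat k * s \<noteq> (1::complex)"
        unfolding F_def eventually_at_filter using k by (auto simp: field_simps)
    qed
    from filterlim_compose[OF riemann_zeta_pole this]
    have "((\<lambda>s. (of_nat k * s - 1) ^ (Q - P) * riemann_zeta (of_nat j * s)) \<longlongrightarrow> of_real 1) F"
      by (simp add: Q True)
    moreover have "(-1) ^ (j - 1) * (-1) ^ (i + P) * 1 = ((-1) ^ (r + Q) * 1 :: real)"
    proof -
      \<comment> \<open>The shift by two leaves the sign unchanged, matching the positive residue 1
        of zeta.\<close>
      have "r + Q = (j - 1) + (i + P) + 2" using j Q by simp
      thus ?thesis by (simp add: power_add)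
    qed
    ultimately show ?thesis by (rule *) auto
  next
    case False
    have "(\<lambda>s. riemann_zeta (of_nat j * s)) analytic_on {1 / of_nat k}"
      using False k by (intro riemann_zeta_scaled_analytic) (auto simp: field_simps)
    hence zeta: "((\<lambda>s. riemann_zeta (of_nat j * s)) \<longlongrightarrow> riemann_zeta (of_nat j * (1 / of_nat k))) F"
      unfolding F_def by (intro isContD analytic_at_imp_isCont)
    show ?thesis
    proof (cases "P = Q")
      case True
      have "j < k"
      proof (rule ccontr)
        assume "\<not> j < k"
        hence "(i + k) div k \<le> r div k" using j by (intro div_le_mono) auto
        thus False using True k by (simp add: P_def Q_def)
      qed
      hence "0 < real j / real k" "real j / real k < 1" using j k by auto
      then obtain y where y: "y < 0" "riemann_zeta (of_real (real j / real k)) = of_real y"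
        by (rule riemann_zeta_neg)
      have "((\<lambda>s. (of_nat k * s - 1) ^ (Q - P) * riemann_zeta (of_nat j * s)) \<longlongrightarrow> of_real y) F"
        using zeta y True by simp
      moreover have "(-1) ^ (j - 1) * (-1) ^ (i + P) * y = (-1) ^ (r + Q) * (-y)"
      proof -
        \<comment> \<open>Here the parity changes, and this is compensated by the negative value of
          zeta at \<open>j / k\<close>.\<close>
        have "r + Q = Suc ((j - 1) + (i + P))" using j True by simp
        thus ?thesis by (simp add: power_add)
      qed
      ultimately show ?thesis by (rule *) (use y in auto)
    next
      case neq: False
      have "((\<lambda>s. (of_nat k * s - 1) ^ (Q - P) * riemann_zeta (of_nat j * s)) \<longlongrightarrow>
              0 ^ (Q - P) * riemann_zeta (of_nat j * (1 / of_nat k))) F"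
        by (intro tendsto_intros lin zeta)
      also have "0 ^ (Q - P) * riemann_zeta (of_nat j * (1 / of_nat k)) = of_real 0"
        using neq PQ by simp
      finally show ?thesis by (rule *) (use neq False in auto)
    qed
  qed
qed

text \<open>The case \<open>k > r\<close> is included because the induction passes through all
  smaller indices; there the power is 0 and the claim fixes the sign of the value itself.\<close>

lemma EZ_newton_limit:
  assumes k: "k \<ge> 1"
  shows "\<exists>C>0. ((\<lambda>s. (of_nat k * s - 1) ^ (r div k) * EZ_newton r s) \<longlongrightarrow>
           complex_of_real ((-1) ^ (r + r div k) * C)) (at (1 / of_nat k))"
proof (induction r rule: less_induct)
  case (less r)
  show ?case
  proof (cases r)
    case 0
    thus ?thesis by (auto intro!: exI[of _ 1])
  next
    case (Suc q)
    define T where "T = (\<lambda>i s. (of_nat k * s - 1) ^ (r div k) *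
      (EZ_newton i s * ((-1) ^ (q - i) * riemann_zeta (of_nat (Suc (q - i)) * s))))"
    have "\<exists>D. D \<ge> 0 \<and>
        (Suc (q - i) = k \<or> Suc (q - i) < k \<and> i div k = r div k \<longrightarrow> D > 0) \<and>
        (T i \<longlongrightarrow> complex_of_real ((-1) ^ (r + r div k) * D)) (at (1 / of_nat k))"
      if i: "i \<le> q" for i
    proof -
      obtain C where C: "C > 0" "((\<lambda>s. (of_nat k * s - 1) ^ (i div k) * EZ_newton i s) \<longlongrightarrow>
           complex_of_real ((-1) ^ (i + i div k) * C)) (at (1 / of_nat k))"
        using less.IH[of i] i Suc by auto
      have "i + Suc (q - i) = r" using i Suc by simp
      from Newton_term_limit[OF k _ this C] obtain D where "D \<ge> 0"
        "Suc (q - i) = k \<or> Suc (q - i) < k \<and> i div k = r div k \<Longrightarrow> D > 0"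
        "((\<lambda>s. (of_nat k * s - 1) ^ (r div k) * (EZ_newton i s *
            ((-1) ^ (Suc (q - i) - 1) * riemann_zeta (of_nat (Suc (q - i)) * s)))) \<longlongrightarrow>
          complex_of_real ((-1) ^ (r + r div k) * D)) (at (1 / of_nat k))"
        by auto
      thus ?thesis by (auto simp: T_def simp del: of_nat_Suc)
    qed
    then obtain D where D: "\<And>i. i \<le> q \<Longrightarrow> D i \<ge> 0"
      "\<And>i. i \<le> q \<Longrightarrow> Suc (q - i) = k \<or> Suc (q - i) < k \<and> i div k = r div k \<Longrightarrow> D i > 0"
      "\<And>i. i \<le> q \<Longrightarrow> (T i \<longlongrightarrow> complex_of_real ((-1) ^ (r + r div k) * D i)) (at (1 / of_nat k))"
      by metis
    \<comment> \<open>For \<open>k \<le> r\<close> the witness is the term with the factor zeta(ks).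
      Otherwise it is \<open>i = q\<close>, whose factor is zeta(s) at a point
      \<open>1 / k < 1\<close>, with both quotients 0.\<close>
    have "\<exists>i\<le>q. D i > 0"
    proof (cases "k \<le> r")
      case True
      thus ?thesis using k Suc by (intro exI[of _ "r - k"] conjI D(2)) auto
    next
      case False
      thus ?thesis using k Suc by (intro exI[of _ q] conjI D(2)) auto
    qed
    hence "(\<Sum>i\<le>q. D i) > 0"
      using D(1) by (auto intro: sum_pos2)
    moreover have "((\<lambda>s. (of_nat k * s - 1) ^ (r div k) * EZ_newton r s) \<longlongrightarrow>
        complex_of_real ((-1) ^ (r + r div k) * ((\<Sum>i\<le>q. D i) / real (Suc q)))) (at (1 / of_nat k))"
    proof -
      have "((\<lambda>s. (\<Sum>i\<le>q. T i s) / of_nat (Suc q)) \<longlongrightarrow>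
              (\<Sum>i\<le>q. complex_of_real ((-1) ^ (r + r div k) * D i)) / of_nat (Suc q)) (at (1 / of_nat k))"
        using D(3) by (intro tendsto_intros) (auto simp del: of_nat_Suc)
      also have "(\<lambda>s. (\<Sum>i\<le>q. T i s) / of_nat (Suc q)) =
                   (\<lambda>s. (of_nat k * s - 1) ^ (r div k) * EZ_newton r s)"
        unfolding T_def by (simp add: Suc EZ_newton_Suc sum_distrib_left del: of_nat_Suc)
      also have "(\<Sum>i\<le>q. complex_of_real ((-1) ^ (r + r div k) * D i)) / of_nat (Suc q) =
                   complex_of_real ((-1) ^ (r + r div k) * ((\<Sum>i\<le>q. D i) / real (Suc q)))"
        by (simp add: sum_distrib_left del: of_nat_Suc)
      finally show ?thesis .
    qed
    ultimately show ?thesis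
      by (intro exI[of _ "(\<Sum>i\<le>q. D i) / real (Suc q)"]) (auto simp del: of_nat_Suc)
  qed
qed

text \<open>With its singularity removed, \<open>(s - z) ^ q * f s\<close> is holomorphic near
  \<open>z\<close> and has the nonzero value \<open>c\<close> there; dividing by the power again
  shows the pole and its order.\<close>

lemma is_pole_zorder_of_limit:
  assumes mero: "f meromorphic_on {z}" and "q > 0" "c \<noteq> 0"
  assumes lim: "((\<lambda>s. (s - z) ^ q * f s) \<longlongrightarrow> c) (at z)"
  shows   "is_pole f z" "zorder f z = - int q"
proof -
  define g where "g = (\<lambda>s. (s - z) ^ q * f s)"
  have "g meromorphic_on {z}"
    unfolding g_def using mero by (intro meromorphic_intros)
  hence iso: "isolated_singularity_at g z"
    by (auto simp: meromorphic_at_iff)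
  have g: "g \<midarrow>z\<rightarrow> c" using lim by (simp add: g_def)
  have "remove_sings g analytic_on {z}"
    using iso g by (rule remove_sings_analytic_at)
  then obtain S where S: "open S" "z \<in> S" "remove_sings g holomorphic_on S"
    by (auto simp: analytic_at)
  have val: "remove_sings g z \<noteq> 0"
    using remove_sings_eqI[OF g] \<open>c \<noteq> 0\<close> by simp
  have ev: "eventually (\<lambda>w. remove_sings g w / (w - z) ^ q = f w) (at z)"
    using eventually_remove_sings_eq_at[OF iso] eventually_neq_at_within[of z]
    by eventually_elim (auto simp: g_def)
  have "is_pole (\<lambda>w. remove_sings g w / (w - z) ^ q) z"
    using S val \<open>q > 0\<close> by (intro is_pole_basic) auto
  thus "is_pole f z" using is_pole_cong[OF ev refl] by simp
  have "zorder (\<lambda>w. remove_sings g w / (w - z) ^ q) z = - int q"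
    using S val \<open>q > 0\<close> by (intro zorder_nonzero_div_power) auto
  thus "zorder f z = - int q" using zorder_cong[OF ev refl] by simp
qed

theorem theorem2:
  fixes r :: nat
  assumes "r \<ge> 1"
  shows "{s. is_pole (EZ_zeta r) s} = {1 / of_nat k |k. 1 \<le> k \<and> k \<le> r}
       \<and> (\<forall>k. 1 \<le> k \<and> k \<le> r \<longrightarrow> zorder (EZ_zeta r) (1 / of_nat k) = - int (r div k))
       \<and> (\<forall>k. 1 \<le> k \<and> k \<le> r \<longrightarrow>
            (\<exists>C::real. C \<noteq> 0 \<and> sgn C = sgn ((-1) ^ (r + r div k)) \<and>
               EZ_zeta r \<sim>[at (1 / of_nat k)]
                 (\<lambda>s. of_real C * (of_nat k * s - 1) powi (- int (r div k)))))"
proof -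
  have iso: "isolated_singularity_at (EZ_newton r) s" for s
    using EZ_newton_meromorphic by (meson UNIV_I meromorphic_on_isolated_singularity meromorphic_on_subset subset_UNIV)
  have ev: "eventually (\<lambda>w. EZ_zeta r w = EZ_newton r w) (at s)" for s
    unfolding EZ_zeta_eq by (rule eventually_remove_sings_eq_at[OF iso])
  have regular: "\<not> is_pole (EZ_zeta r) s" if "s \<notin> {1 / of_nat k |k. 1 \<le> k \<and> k \<le> r}" for s
  proof -
    have "EZ_newton r analytic_on {s}"
      using that by (intro EZ_newton_analytic) (auto simp: field_simps)
    hence "\<not> is_pole (EZ_newton r) s"
      using analytic_at not_is_pole_holomorphic by blast
    thus ?thesis using is_pole_cong[OF ev refl] by simp
  qed
  have *: "is_pole (EZ_zeta r) (1 / of_nat k) \<and> zorder (EZ_zeta r) (1 / of_nat k) = - int (r div k) \<and>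
           (\<exists>C::real. C \<noteq> 0 \<and> sgn C = sgn ((-1) ^ (r + r div k)) \<and>
               EZ_zeta r \<sim>[at (1 / of_nat k)]
                 (\<lambda>s. of_real C * (of_nat k * s - 1) powi (- int (r div k))))"
    if k: "1 \<le> k" "k \<le> r" for k
  proof -
    define q where "q = r div k"
    define z where "z = (1 / of_nat k :: complex)"
    have q: "q > 0" using k by (simp add: q_def div_greater_zero_iff)
    obtain C0 where C0: "C0 > 0"
      "((\<lambda>s. (of_nat k * s - 1) ^ q * EZ_newton r s) \<longlongrightarrow> complex_of_real ((-1) ^ (r + q) * C0)) (at z)"
      using EZ_newton_limit[OF k(1), of r] unfolding q_def z_def by blast
    define C where "C = (-1) ^ (r + q) * C0"
    have C: "C \<noteq> 0" "sgn C = sgn ((-1) ^ (r + q))"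
      using C0(1) by (auto simp: C_def sgn_mult)
    have "((\<lambda>s. (of_nat k * s - 1) ^ q * EZ_newton r s) \<longlongrightarrow> of_real C) (at z)"
      using C0(2) by (simp add: C_def)
    moreover have "eventually (\<lambda>s. (of_nat k * s - 1) ^ q * EZ_newton r s =
                                   (of_nat k * s - 1) ^ q * EZ_zeta r s) (at z)"
      using ev[of z] by eventually_elim simp
    ultimately have lim: "((\<lambda>s. (of_nat k * s - 1) ^ q * EZ_zeta r s) \<longlongrightarrow> of_real C) (at z)"
      by (rule Lim_transform_eventually)
    \<comment> \<open>Since \<open>of_nat k * s - 1 = of_nat k * (s - z)\<close>, dividing by
      \<open>of_nat k ^ q\<close> gives the normalisation needed for the order of the pole.\<close>
    have "((\<lambda>s. (of_nat k * s - 1) ^ q * EZ_zeta r s / of_nat k ^ q) \<longlongrightarrow> of_real C / of_nat k ^ q) (at z)"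
      using k by (intro tendsto_intros lim) auto
    also have "(\<lambda>s. (of_nat k * s - 1) ^ q * EZ_zeta r s / of_nat k ^ q) =
                 (\<lambda>s. (s - z) ^ q * EZ_zeta r s)"
    proof
      fix s
      have "of_nat k * s - 1 = of_nat k * (s - z)"
        using k by (simp add: z_def algebra_simps)
      thus "(of_nat k * s - 1) ^ q * EZ_zeta r s / of_nat k ^ q = (s - z) ^ q * EZ_zeta r s"
        using k by (simp add: power_mult_distrib)
    qed
    finally have lim': "((\<lambda>s. (s - z) ^ q * EZ_zeta r s) \<longlongrightarrow> of_real C / of_nat k ^ q) (at z)" .
    have "EZ_zeta r meromorphic_on {z}"
      unfolding EZ_zeta_eq
      using meromorphic_on_subset[OF EZ_newton_meromorphic] by (intro remove_sings_meromorphic) auto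
    from is_pole_zorder_of_limit[OF this q _ lim'] have "is_pole (EZ_zeta r) z" "zorder (EZ_zeta r) z = - int q"
      using C k by auto
    moreover have "EZ_zeta r \<sim>[at z] (\<lambda>s. of_real C * (of_nat k * s - 1) powi (- int q))"
      using lim C by (intro asymp_equivI'_const) (auto simp: power_int_minus divide_inverse mult.commute)
    ultimately show ?thesis using C unfolding q_def z_def by blast
  qed
  have "{s. is_pole (EZ_zeta r) s} = {1 / of_nat k |k. 1 \<le> k \<and> k \<le> r}"
    using regular * by blast
  with * show ?thesis by blast
qed

end
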